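(* Let $S=\mathcal{DP}_n$ and let $\alpha,\beta\in S$. Then $\alpha\le_{\mathcal D}\beta$ if and only if there exists an isometry $\theta:\mathrm{Dom}\,\alpha\to\mathrm{Dom}\,\beta$, i.e. a (not necessarily surjective) map $\theta$ from $\mathrm{Dom}\,\alpha$ into $\mathrm{Dom}\,\beta$ with $|x-y|=|x\theta-y\theta|$ for all $x,y\in\mathrm{Dom}\,\alpha$.
   Context: For $n\ge 0$ let $X_n=\{1,2,\dots,n\}$ and let $\mathcal{I}_n$ be the symmetric inverse semigroup of all partial injective maps of $X_n$ (including the empty map). Maps are written on the right and composed left to right: $x(\alpha\beta)=(x\alpha)\beta$. $\mathcal{DP}_n$ is the subsemigroup of all $\alpha\in\mathcal{I}_n$ with $|x-y|=|x\alpha-y\alpha|$ for all $x,y\in\mathrm{Dom}\,\alpha$ (partial isometries); it contains the identity of $X_n$. For a monoid $S$ and $a,b\in S$: $a\le_{\mathcal R}b$ means $a=bs$ for some $s\in S$; $a\le_{\mathcal L}b$ means $a=sb$ for some $s\in S$; $a\le_{\mathcal D}b$ means there exists $d\in S$ with $a\le_{\mathcal R}d$ and $d\le_{\mathcal L}b$. *)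

theory Defs
  imports "HOL-Algebra.Group"
begin

definition sym_inv :: "nat \<Rightarrow> (nat \<rightharpoonup> nat) set"
  where "sym_inv n = {\<alpha>. dom \<alpha> \<subseteq> {1..n} \<and> ran \<alpha> \<subseteq> {1..n} \<and> inj_on \<alpha> (dom \<alpha>)}"

text \<open>Distances are taken in \<^typ>\<open>int\<close>, since subtraction on \<^typ>\<open>nat\<close> truncates.\<close>

definition dist_preserving_on :: "nat set \<Rightarrow> (nat \<Rightarrow> nat) \<Rightarrow> bool"
  where "dist_preserving_on A f \<longleftrightarrow>
    (\<forall>x\<in>A. \<forall>y\<in>A. \<bar>int x - int y\<bar> = \<bar>int (f x) - int (f y)\<bar>)"

text \<open>An isometry from \<open>A\<close> into \<open>B\<close>, not necessarily onto. Only the values of \<open>f\<close> on \<open>A\<close> matter.\<close>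

definition isometry_into :: "nat set \<Rightarrow> nat set \<Rightarrow> (nat \<Rightarrow> nat) \<Rightarrow> bool"
  where "isometry_into A B f \<longleftrightarrow> f ` A \<subseteq> B \<and> dist_preserving_on A f"

text \<open>Maps are written on the right, so the product \<open>\<alpha>\<beta>\<close> is ``first \<open>\<alpha>\<close>, then \<open>\<beta>\<close>'',
  whereas \<^term>\<open>(\<circ>\<^sub>m)\<close> applies its right argument first.\<close>

definition DP :: "nat \<Rightarrow> (nat \<rightharpoonup> nat) monoid"
  where "DP n =
    \<lparr>carrier = {\<alpha> \<in> sym_inv n. dist_preserving_on (dom \<alpha>) (\<lambda>x. the (\<alpha> x))},
     mult = (\<lambda>\<alpha> \<beta>. \<beta> \<circ>\<^sub>m \<alpha>),
     one = (\<lambda>x. if x \<in> {1..n} then Some x else None)\<rparr>"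

definition le_R :: "('a, 'm) monoid_scheme \<Rightarrow> 'a \<Rightarrow> 'a \<Rightarrow> bool"
  where "le_R S a b \<longleftrightarrow> (\<exists>s\<in>carrier S. a = b \<otimes>\<^bsub>S\<^esub> s)"

definition le_L :: "('a, 'm) monoid_scheme \<Rightarrow> 'a \<Rightarrow> 'a \<Rightarrow> bool"
  where "le_L S a b \<longleftrightarrow> (\<exists>s\<in>carrier S. a = s \<otimes>\<^bsub>S\<^esub> b)"

definition le_D :: "('a, 'm) monoid_scheme \<Rightarrow> 'a \<Rightarrow> 'a \<Rightarrow> bool"
  where "le_D S a b \<longleftrightarrow> (\<exists>d\<in>carrier S. le_R S a d \<and> le_L S d b)"

lemma DP_closed:
  assumes "\<alpha> \<in> carrier (DP n)" "\<beta> \<in> carrier (DP n)"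
  shows "\<beta> \<circ>\<^sub>m \<alpha> \<in> carrier (DP n)"
proof -
  have a: "dom \<alpha> \<subseteq> {1..n}" "inj_on \<alpha> (dom \<alpha>)" "dist_preserving_on (dom \<alpha>) (\<lambda>x. the (\<alpha> x))"
    and b: "ran \<beta> \<subseteq> {1..n}" "inj_on \<beta> (dom \<beta>)" "dist_preserving_on (dom \<beta>) (\<lambda>x. the (\<beta> x))"
    using assms by (auto simp: DP_def sym_inv_def)
  have "dom (\<beta> \<circ>\<^sub>m \<alpha>) \<subseteq> {1..n}"
    using a(1) by (fastforce simp: map_comp_Some_iff dom_def)
  moreover have "ran (\<beta> \<circ>\<^sub>m \<alpha>) \<subseteq> {1..n}"
    using b(1) by (auto simp: ran_def map_comp_Some_iff)
  moreover have "inj_on (\<beta> \<circ>\<^sub>m \<alpha>) (dom (\<beta> \<circ>\<^sub>m \<alpha>))"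
  proof (rule inj_onI)
    fix x y
    assume "x \<in> dom (\<beta> \<circ>\<^sub>m \<alpha>)" and e: "(\<beta> \<circ>\<^sub>m \<alpha>) x = (\<beta> \<circ>\<^sub>m \<alpha>) y"
    then obtain z where "(\<beta> \<circ>\<^sub>m \<alpha>) x = Some z" "(\<beta> \<circ>\<^sub>m \<alpha>) y = Some z"
      by (metis domD)
    then obtain u v where uv: "\<alpha> x = Some u" "\<beta> u = Some z" "\<alpha> y = Some v" "\<beta> v = Some z"
      by (auto simp: map_comp_Some_iff)
    have "u = v"
      using inj_onD[OF b(2), of u v] uv by auto
    then show "x = y"
      using inj_onD[OF a(2), of x y] uv by auto
  qed
  moreover have "dist_preserving_on (dom (\<beta> \<circ>\<^sub>m \<alpha>)) (\<lambda>x. the ((\<beta> \<circ>\<^sub>m \<alpha>) x))"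
    unfolding dist_preserving_on_def
  proof (intro ballI)
    fix x y
    assume "x \<in> dom (\<beta> \<circ>\<^sub>m \<alpha>)" "y \<in> dom (\<beta> \<circ>\<^sub>m \<alpha>)"
    then obtain u v z w where *: "\<alpha> x = Some u" "\<beta> u = Some z" "\<alpha> y = Some v" "\<beta> v = Some w"
      by (auto simp: map_comp_Some_iff)
    have "\<bar>int x - int y\<bar> = \<bar>int u - int v\<bar>"
      using a(3) * unfolding dist_preserving_on_def by (metis domI option.sel)
    also have "\<dots> = \<bar>int z - int w\<bar>"
      using b(3) * unfolding dist_preserving_on_def by (metis domI option.sel)
    finally show "\<bar>int x - int y\<bar> = \<bar>int (the ((\<beta> \<circ>\<^sub>m \<alpha>) x)) - int (the ((\<beta> \<circ>\<^sub>m \<alpha>) y))\<bar>"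
      using * by simp
  qed
  ultimately show ?thesis
    by (simp add: DP_def sym_inv_def)
qed

lemma monoid_DP: "monoid (DP n)"
proof (rule monoidI)
  show "\<one>\<^bsub>DP n\<^esub> \<in> carrier (DP n)"
    by (auto simp: DP_def sym_inv_def dist_preserving_on_def ran_def inj_on_def split: if_splits)
next
  fix x y assume "x \<in> carrier (DP n)" "y \<in> carrier (DP n)"
  then show "x \<otimes>\<^bsub>DP n\<^esub> y \<in> carrier (DP n)"
    using DP_closed[of x n y] by (simp add: DP_def)
next
  fix x y z
  show "x \<otimes>\<^bsub>DP n\<^esub> y \<otimes>\<^bsub>DP n\<^esub> z = x \<otimes>\<^bsub>DP n\<^esub> (y \<otimes>\<^bsub>DP n\<^esub> z)"
    by (auto simp: DP_def map_comp_def split: option.splits)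
next
  fix x assume x: "x \<in> carrier (DP n)"
  show "\<one>\<^bsub>DP n\<^esub> \<otimes>\<^bsub>DP n\<^esub> x = x"
  proof
    fix k
    have "k \<in> {1..n} \<or> x k = None"
      using x by (auto simp: DP_def sym_inv_def)
    then show "(\<one>\<^bsub>DP n\<^esub> \<otimes>\<^bsub>DP n\<^esub> x) k = x k"
      by (auto simp: DP_def map_comp_def)
  qed
  show "x \<otimes>\<^bsub>DP n\<^esub> \<one>\<^bsub>DP n\<^esub> = x"
  proof
    fix k
    have "x k = Some m \<Longrightarrow> m \<in> {1..n}" for m
      using x by (auto simp: DP_def sym_inv_def ran_def)
    then show "(x \<otimes>\<^bsub>DP n\<^esub> \<one>\<^bsub>DP n\<^esub>) k = x k"
      by (auto simp: DP_def map_comp_def split: option.splits)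
  qed
qed

end

theory Submission
  imports Defs
begin

text \<open>By definition \<open>\<alpha> \<le>\<^sub>D \<beta>\<close> says \<open>\<alpha> = \<tau>\<beta>\<sigma>\<close> with \<open>\<tau>, \<sigma> \<in> DP\<^sub>n\<close>. Given such a factorisation, \<open>\<tau>\<close>
  maps \<open>Dom \<alpha>\<close> into \<open>Dom \<beta>\<close> isometrically. Conversely, given \<open>\<theta>\<close>, take \<open>\<tau> = \<theta>\<close>
  on \<open>Dom \<alpha>\<close>; then \<open>\<theta>\<beta>\<close> is injective on \<open>Dom \<alpha>\<close> and \<open>\<sigma> = (\<theta>\<beta>)\<^sup>-\<^sup>1\<alpha>\<close> completes the
  factorisation.\<close>

lemma dist_preserving_on_inj_on: "dist_preserving_on A f \<Longrightarrow> inj_on f A"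
  unfolding dist_preserving_on_def inj_on_def by fastforce

lemma dist_preserving_on_subset:
  "dist_preserving_on B f \<Longrightarrow> A \<subseteq> B \<Longrightarrow> dist_preserving_on A f"
  unfolding dist_preserving_on_def by blast

lemma dist_preserving_on_comp:
  assumes "dist_preserving_on A f" "dist_preserving_on B g" "f ` A \<subseteq> B"
  shows "dist_preserving_on A (\<lambda>x. g (f x))"
  using assms unfolding dist_preserving_on_def by (simp add: image_subset_iff)

text \<open>Since \<open>f\<close> is injective on \<open>A\<close>,
  \<open>inv_into A f (f x) = x\<close> there, so the claim is the hypothesis read from right to
  left.\<close>

lemma dist_preserving_on_inv_into:
  assumes "dist_preserving_on A f"
  shows "dist_preserving_on (f ` A) (inv_into A f)"
  using assms by (simp add: dist_preserving_on_def dist_preserving_on_inj_on)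

text \<open>Produces both outer factors of the converse direction; injectivity comes from
  preservation of distances.\<close>

lemma restrict_map_in_DP:
  assumes "A \<subseteq> {1..n}" "f ` A \<subseteq> {1..n}" "dist_preserving_on A f"
  shows "(\<lambda>x. Some (f x)) |` A \<in> carrier (DP n)"
proof -
  have "dom ((\<lambda>x. Some (f x)) |` A) = A" "ran ((\<lambda>x. Some (f x)) |` A) = f ` A"
    by (auto simp: ran_def restrict_map_def split: if_splits)
  then show ?thesis
    using assms dist_preserving_on_inj_on[OF assms(3)]
    by (simp add: DP_def sym_inv_def dist_preserving_on_def inj_on_def)
qed

lemma DP_D:
  assumes "\<alpha> \<in> carrier (DP n)"
  shows "dom \<alpha> \<subseteq> {1..n}" "(\<lambda>x. the (\<alpha> x)) ` dom \<alpha> \<subseteq> {1..n}"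
    "dist_preserving_on (dom \<alpha>) (\<lambda>x. the (\<alpha> x))"
  using assms by (auto simp: DP_def sym_inv_def ran_def)

theorem theorem2p2:
  fixes n :: nat and \<alpha> \<beta> :: "nat \<rightharpoonup> nat"
  assumes "\<alpha> \<in> carrier (DP n)" and "\<beta> \<in> carrier (DP n)"
  shows "le_D (DP n) \<alpha> \<beta> \<longleftrightarrow> (\<exists>\<theta>. isometry_into (dom \<alpha>) (dom \<beta>) \<theta>)"
proof
  assume "le_D (DP n) \<alpha> \<beta>"
  then obtain \<sigma> \<tau> where \<tau>: "\<tau> \<in> carrier (DP n)" and eq: "\<alpha> = \<sigma> \<circ>\<^sub>m (\<beta> \<circ>\<^sub>m \<tau>)"
    unfolding le_D_def le_R_def le_L_def by (auto simp: DP_def)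
  \<comment> \<open>A composite is defined at a point only if every stage is. The first inclusion
    may be proper, so \<tau> is restricted to \<open>dom \<alpha>\<close> below.\<close>
  have "dom \<alpha> \<subseteq> dom \<tau>" and "(\<lambda>x. the (\<tau> x)) ` dom \<alpha> \<subseteq> dom \<beta>"
    unfolding eq by (auto simp: map_comp_Some_iff)
  then have "isometry_into (dom \<alpha>) (dom \<beta>) (\<lambda>x. the (\<tau> x))"
    unfolding isometry_into_def
    using dist_preserving_on_subset[OF DP_D(3)[OF \<tau>]] by blast
  then show "\<exists>\<theta>. isometry_into (dom \<alpha>) (dom \<beta>) \<theta>"
    by blast
next
  assume "\<exists>\<theta>. isometry_into (dom \<alpha>) (dom \<beta>) \<theta>"
  then obtain \<theta> where \<theta>: "\<theta> ` dom \<alpha> \<subseteq> dom \<beta>" "dist_preserving_on (dom \<alpha>) \<theta>"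
    unfolding isometry_into_def by blast
  define f where "f = (\<lambda>x. the (\<beta> (\<theta> x)))"
  define g where "g = (\<lambda>y. the (\<alpha> (inv_into (dom \<alpha>) f y)))"
  define \<tau> where "\<tau> = (\<lambda>x. Some (\<theta> x)) |` dom \<alpha>"
  define \<sigma> where "\<sigma> = (\<lambda>y. Some (g y)) |` (f ` dom \<alpha>)"
  note A = DP_D[OF assms(1)] and B = DP_D[OF assms(2)]
  have f: "dist_preserving_on (dom \<alpha>) f"
    unfolding f_def using dist_preserving_on_comp[OF \<theta>(2) B(3) \<theta>(1)] .
  \<comment> \<open>Injectivity of \<open>f\<close> makes \<open>inv_into\<close> recover
    \<open>x\<close> itself.\<close>
  have g_f: "g (f x) = the (\<alpha> x)" if "x \<in> dom \<alpha>" for x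
    using that dist_preserving_on_inj_on[OF f] by (simp add: g_def)
  have \<tau>: "\<tau> \<in> carrier (DP n)"
    unfolding \<tau>_def using A(1) B(1) \<theta> by (intro restrict_map_in_DP) auto
  have \<sigma>: "\<sigma> \<in> carrier (DP n)"
    unfolding \<sigma>_def
  proof (rule restrict_map_in_DP)
    show "f ` dom \<alpha> \<subseteq> {1..n}"
      using B(2) \<theta>(1) unfolding f_def by blast
    show "g ` f ` dom \<alpha> \<subseteq> {1..n}"
      using A(2) by (simp add: image_image g_f cong: image_cong_simp)
    show "dist_preserving_on (f ` dom \<alpha>) g"
      unfolding g_def
      using dist_preserving_on_comp[OF dist_preserving_on_inv_into[OF f] A(3)]
      by (simp add: image_subset_iff inv_into_into)
  qed
  have "\<alpha> x = (\<sigma> \<circ>\<^sub>m (\<beta> \<circ>\<^sub>m \<tau>)) x" for x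
  proof (cases "x \<in> dom \<alpha>")
    case True
    \<comment> \<open>This makes \<open>the\<close> in \<open>f\<close> return a genuine value of
      \<beta>.\<close>
    then have "\<theta> x \<in> dom \<beta>"
      using \<theta>(1) by blast
    then have "\<beta> (\<theta> x) = Some (f x)"
      by (auto simp: f_def)
    with True show ?thesis
      by (auto simp: map_comp_def \<tau>_def \<sigma>_def g_f)
  next
    case False
    \<comment> \<open>Outside \<open>dom \<alpha>\<close> already \<tau> is undefined.\<close>
    then show ?thesis
      by (auto simp: map_comp_def \<tau>_def)
  qed
  then have "\<alpha> = \<sigma> \<circ>\<^sub>m (\<beta> \<circ>\<^sub>m \<tau>)" ..
  \<comment> \<open>The intermediate element is the product \<tau>\<beta>, that is
    \<open>\<beta> \<circ>\<^sub>m \<tau>\<close>.\<close>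
  then show "le_D (DP n) \<alpha> \<beta>"
    unfolding le_D_def le_R_def le_L_def
    using \<tau> \<sigma> DP_closed[OF \<tau> assms(2)] by (auto simp: DP_def)
qed

end
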